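(* Let $p\ge 2$ be arbitrary and let $\{(x_j^k,y_j^k)_{j=0}^{n_k}\}_{k=1}^K$ be the iterates generated by the Multistage Stochastic Gradient Descent Ascent algorithm (M-GDA) with parameters $$\alpha_1=\frac{\mu}{4L^2},\quad n_1\ge 1,\qquad \alpha_k=\frac{\mu}{L^2\,2^{k+2}},\quad n_k=\left\lceil p\,2^{k+2}\kappa^2\log 2\right\rceil\quad (k\ge 2).$$ Then for every $k\ge 1$ (i.e. $1\le k\le K$), $$\mathbb{E}\big[\|z_{n_k}^k-z^*\|^2\big]\le \frac{\exp\left(-n_1/(4\kappa^2)\right)}{2^{p(k-1)}}\,\|z_0-z^*\|^2+\frac{\sigma^2}{2^kL^2},$$ where $z_j^k=((x_j^k)^\top,(y_j^k)^\top)^\top$ for $0\le j\le n_k$ and $z_0$ is the initial point of the algorithm.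
   Context: Objective. $f:\mathbb{R}^m\times\mathbb{R}^n\to\mathbb{R}$ is continuously differentiable. A convex function $\phi$ is called $\ell$-smooth if $\|\nabla\phi(u)-\nabla\phi(v)\|\le \ell\|u-v\|$ for all $u,v$, and $\nu$-strongly convex if $\phi(u)-\phi(v)-\nabla\phi(v)^\top(u-v)\ge\frac{\nu}{2}\|u-v\|^2$ for all $u,v$; $\phi$ is $\nu$-strongly concave if $-\phi$ is $\nu$-strongly convex. For every $\hat y$, $f(\cdot,\hat y)$ is $L_x$-smooth and $\mu_x$-strongly convex; for every $\hat x$, $f(\hat x,\cdot)$ is $L_y$-smooth and $\mu_y$-strongly concave ($\mu_x,\mu_y>0$). Moreover $\|\nabla_xf(x,y)-\nabla_xf(x,\hat y)\|\le L_{xy}\|y-\hat y\|$ for all $x,y,\hat y$ and $\|\nabla_yf(x,y)-\nabla_yf(\hat x,y)\|\le L_{yx}\|x-\hat x\|$ for all $x,\hat x,y$. Set $\mu=\min\{\mu_x,\mu_y\}$, $L=\max\{L_x,L_y,L_{xy},L_{yx}\}$ and $\kappa=L/\mu$. Then $f$ has a unique saddle point $(x^*,y^* )$, i.e. $f(x^*,y)\le f(x^*,y^* )\le f(x,y^* )$ for all $x,y$. Write $z=(x^\top,y^\top)^\top\in\mathbb{R}^{m+n}$ and $z^*=(x^{*\top},y^{*\top})^\top$; norms are Euclidean. Stochastic oracle. At an iterate $(x,y)$ one has access to random estimates $\tilde\nabla_xf(x,y)$ (using a random sample $\zeta$) and $\tilde\nabla_yf(x,y)$ (using a random sample $\xi$),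 where $\zeta,\xi$ are independent of each other and of previous iterates, such that $\mathbb{E}[\tilde\nabla_xf(x,y)\mid(x,y)]=\nabla_xf(x,y)$, $\mathbb{E}[\tilde\nabla_yf(x,y)\mid(x,y)]=\nabla_yf(x,y)$, $\mathbb{E}[\|\tilde\nabla_xf(x,y)-\nabla_xf(x,y)\|^2\mid(x,y)]\le\sigma^2$ and $\mathbb{E}[\|\tilde\nabla_yf(x,y)-\nabla_yf(x,y)\|^2\mid(x,y)]\le\sigma^2$. Fresh samples are drawn at each iterate. M-GDA. Input: an initial point $z_0=((x_0^0)^\top,(y_0^0)^\top)^\top$, stepsizes $\{\alpha_k\}_{k=1}^K$, stage lengths $\{n_k\}_{k=1}^K$ (positive integers). Set $n_0=0$. For $k=1,\dots,K$: set $x_0^k=x_{n_{k-1}}^{k-1}$, $y_0^k=y_{n_{k-1}}^{k-1}$, and for $j=0,\dots,n_k-1$ set $x_{j+1}^k=x_j^k-\alpha_k\tilde\nabla_xf(x_j^k,y_j^k)$ and $y_{j+1}^k=y_j^k+\alpha_k\tilde\nabla_yf(x_j^k,y_j^k)$. *)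

theory Defs
  imports "HOL-Probability.Probability"
begin

section \<open>Differentiable functions on Euclidean spaces\<close>

text \<open>Points \<open>z = (x, y)\<close> live in the product type, whose library norm is the Euclidean one,
  \<open>norm (x, y) = sqrt ((norm x)\<^sup>2 + (norm y)\<^sup>2)\<close>.\<close>

definition grad :: "('a::real_inner \<Rightarrow> real) \<Rightarrow> 'a \<Rightarrow> 'a" where
  "grad \<phi> u = (THE D. GDERIV \<phi> u :> D)"

definition continuously_differentiable :: "('a::real_inner \<Rightarrow> real) \<Rightarrow> bool" where
  "continuously_differentiable \<phi> \<longleftrightarrow>
     (\<forall>u. \<phi> differentiable (at u)) \<and> continuous_on UNIV (grad \<phi>)"

definition grad_x :: "('a::real_inner \<times> 'b::real_inner \<Rightarrow> real) \<Rightarrow> 'a \<times> 'b \<Rightarrow> 'a" where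
  "grad_x f z = grad (\<lambda>x. f (x, snd z)) (fst z)"

definition grad_y :: "('a::real_inner \<times> 'b::real_inner \<Rightarrow> real) \<Rightarrow> 'a \<times> 'b \<Rightarrow> 'b" where
  "grad_y f z = grad (\<lambda>y. f (fst z, y)) (snd z)"

text \<open>The next three notions are meant for differentiable functions. Convexity is not part of
  \<open>smooth\<close>, so that it applies to concave functions as well.\<close>

definition smooth :: "real \<Rightarrow> ('a::real_inner \<Rightarrow> real) \<Rightarrow> bool" where
  "smooth l \<phi> \<longleftrightarrow> (\<forall>u v. norm (grad \<phi> u - grad \<phi> v) \<le> l * norm (u - v))"

definition strongly_convex :: "real \<Rightarrow> ('a::real_inner \<Rightarrow> real) \<Rightarrow> bool" where
  "strongly_convex \<nu> \<phi> \<longleftrightarrow>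
     (\<forall>u v. \<phi> u - \<phi> v - grad \<phi> v \<bullet> (u - v) \<ge> \<nu> / 2 * (norm (u - v))\<^sup>2)"

definition strongly_concave :: "real \<Rightarrow> ('a::real_inner \<Rightarrow> real) \<Rightarrow> bool" where
  "strongly_concave \<nu> \<phi> \<longleftrightarrow> strongly_convex \<nu> (\<lambda>u. - \<phi> u)"

definition saddle_point :: "('a \<times> 'b \<Rightarrow> real) \<Rightarrow> 'a \<times> 'b \<Rightarrow> bool" where
  "saddle_point f z \<longleftrightarrow>
     (\<forall>x y. f (fst z, y) \<le> f z \<and> f z \<le> f (x, snd z))"


section \<open>The algorithm\<close>

text \<open>\<open>Gx z s\<close> and \<open>Gy z t\<close> are the estimates of the partial gradients at \<open>z\<close> computed from the
  samples \<open>s\<close> and \<open>t\<close>; \<open>\<zeta> k j\<close> and \<open>\<xi> k j\<close> are the samples drawn at the \<open>j\<close>-th iterate of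
  stage \<open>k\<close>. Stage \<open>0\<close> consists of the initial point only, which renders the convention
  \<open>n\<^sub>0 = 0\<close>: the value \<open>n 0\<close> is irrelevant.\<close>

fun mgda :: "('a::real_vector \<times> 'b::real_vector \<Rightarrow> 's \<Rightarrow> 'a) \<Rightarrow> ('a \<times> 'b \<Rightarrow> 't \<Rightarrow> 'b) \<Rightarrow>
    (nat \<Rightarrow> nat \<Rightarrow> 'w \<Rightarrow> 's) \<Rightarrow> (nat \<Rightarrow> nat \<Rightarrow> 'w \<Rightarrow> 't) \<Rightarrow> (nat \<Rightarrow> real) \<Rightarrow> (nat \<Rightarrow> nat) \<Rightarrow>
    'a \<times> 'b \<Rightarrow> nat \<Rightarrow> nat \<Rightarrow> 'w \<Rightarrow> 'a \<times> 'b" where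
  "mgda Gx Gy \<zeta> \<xi> \<alpha> n z0 0 j \<omega> = z0"
| "mgda Gx Gy \<zeta> \<xi> \<alpha> n z0 (Suc k) 0 \<omega> = mgda Gx Gy \<zeta> \<xi> \<alpha> n z0 k (n k) \<omega>"
| "mgda Gx Gy \<zeta> \<xi> \<alpha> n z0 (Suc k) (Suc j) \<omega> =
     (let z = mgda Gx Gy \<zeta> \<xi> \<alpha> n z0 (Suc k) j \<omega> in
       (fst z - \<alpha> (Suc k) *\<^sub>R Gx z (\<zeta> (Suc k) j \<omega>),
        snd z + \<alpha> (Suc k) *\<^sub>R Gy z (\<xi> (Suc k) j \<omega>)))"


section \<open>The stochastic oracle\<close>

definition generated :: "'w measure \<Rightarrow> 'v measure \<Rightarrow> ('w \<Rightarrow> 'v) \<Rightarrow> 'w measure" where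
  "generated M N X = vimage_algebra (space M) X N"

text \<open>The events determined by all iterates \<open>Z l i\<close> computed up to the \<open>j\<close>-th iterate of stage \<open>k\<close>,
  this iterate included.\<close>

definition history :: "'w measure \<Rightarrow> (nat \<Rightarrow> nat) \<Rightarrow> (nat \<Rightarrow> nat \<Rightarrow> 'w \<Rightarrow> 'v::topological_space) \<Rightarrow>
    nat \<Rightarrow> nat \<Rightarrow> 'w set set" where
  "history M n Z k j = sigma_sets (space M)
     (\<Union>(l, i) \<in> {(l, i). l < k \<and> i \<le> n l \<or> l = k \<and> i \<le> j}. sets (generated M borel (Z l i)))"

text \<open>\<open>E[X | F] = Y\<close> almost surely for vector-valued \<open>X\<close>; the library's conditional expectation
  is real-valued, hence the coordinates.\<close>

definition cond_mean :: "'w measure \<Rightarrow> 'w measure \<Rightarrow> ('w \<Rightarrow> 'v::euclidean_space) \<Rightarrow> ('w \<Rightarrow> 'v) \<Rightarrow> bool"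
  where "cond_mean M F X Y \<longleftrightarrow> integrable M X \<and>
     (\<forall>b\<in>Basis. AE \<omega> in M. real_cond_exp M F (\<lambda>\<omega>. X \<omega> \<bullet> b) \<omega> = Y \<omega> \<bullet> b)"

text \<open>The oracle assumptions at the \<open>j\<close>-th iterate of stage \<open>k\<close> of a process \<open>Z\<close>. The conditional
  variance is a nonnegative extended expectation, so its bound entails square integrability.\<close>

definition stochastic_oracle_at ::
  "'w measure \<Rightarrow> ('a::euclidean_space \<times> 'b::euclidean_space \<Rightarrow> real) \<Rightarrow> real \<Rightarrow>
    's measure \<Rightarrow> 't measure \<Rightarrow> ('a \<times> 'b \<Rightarrow> 's \<Rightarrow> 'a) \<Rightarrow> ('a \<times> 'b \<Rightarrow> 't \<Rightarrow> 'b) \<Rightarrow>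
    (nat \<Rightarrow> nat \<Rightarrow> 'w \<Rightarrow> 's) \<Rightarrow> (nat \<Rightarrow> nat \<Rightarrow> 'w \<Rightarrow> 't) \<Rightarrow> (nat \<Rightarrow> nat) \<Rightarrow>
    (nat \<Rightarrow> nat \<Rightarrow> 'w \<Rightarrow> 'a \<times> 'b) \<Rightarrow> nat \<Rightarrow> nat \<Rightarrow> bool" where
  "stochastic_oracle_at M f \<sigma> S T Gx Gy \<zeta> \<xi> n Z k j \<longleftrightarrow>
     \<zeta> k j \<in> measurable M S \<and> \<xi> k j \<in> measurable M T \<and>
     \<comment> \<open>the two conditions together: \<open>\<zeta> k j\<close>, \<open>\<xi> k j\<close> and the history are mutually independent\<close>
     prob_space.indep_set M (sets (generated M S (\<zeta> k j))) (sets (generated M T (\<xi> k j))) \<and>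
     prob_space.indep_set M (sets (generated M (S \<Otimes>\<^sub>M T) (\<lambda>\<omega>. (\<zeta> k j \<omega>, \<xi> k j \<omega>))))
       (history M n Z k j) \<and>
     (let F = generated M borel (Z k j);
          gx = (\<lambda>\<omega>. Gx (Z k j \<omega>) (\<zeta> k j \<omega>));
          gy = (\<lambda>\<omega>. Gy (Z k j \<omega>) (\<xi> k j \<omega>)) in
        cond_mean M F gx (\<lambda>\<omega>. grad_x f (Z k j \<omega>)) \<and>
        cond_mean M F gy (\<lambda>\<omega>. grad_y f (Z k j \<omega>)) \<and>
        (AE \<omega> in M. nn_cond_exp M F (\<lambda>\<omega>. ennreal ((norm (gx \<omega> - grad_x f (Z k j \<omega>)))\<^sup>2)) \<omega>
           \<le> ennreal (\<sigma>\<^sup>2)) \<and>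
        (AE \<omega> in M. nn_cond_exp M F (\<lambda>\<omega>. ennreal ((norm (gy \<omega> - grad_y f (Z k j \<omega>)))\<^sup>2)) \<omega>
           \<le> ennreal (\<sigma>\<^sup>2)))"

end

theory Submission
  imports Defs
begin

text \<open>The field \<open>z \<mapsto> (\<nabla>\<^sub>xf z, -\<nabla>\<^sub>yf z)\<close> vanishes at the saddle point, is strongly monotone
  there with modulus \<open>\<mu>\<close>, and is Lipschitz with constant \<open>2L\<close>, so for a stepsize
  \<open>\<alpha> \<le> \<mu> / (4L\<^sup>2)\<close> an exact step contracts the squared distance to the saddle point by the factor
  \<open>1 - \<alpha>\<mu>\<close>. The gradient noise is uncorrelated with the exact step and adds at most
  \<open>2\<alpha>\<^sup>2\<sigma>\<^sup>2\<close>. Writing \<open>E\<^sub>k\<close> for the mean squared distance after stage \<open>k\<close>, iteration gives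
  \<open>E\<^sub>k \<le> exp(-\<alpha>\<^sub>k\<mu>n\<^sub>k) E\<^sub>k\<^sub>-\<^sub>1 + 2\<alpha>\<^sub>k\<sigma>\<^sup>2 / \<mu>\<close>; the stage lengths make the exponential at most
  \<open>2\<^bsup>-p\<^esup> \<le> 1/4\<close>, and the claim follows by induction on \<open>k\<close>.\<close>

section \<open>Gradients and strong convexity on Euclidean spaces\<close>

lemma gderiv_unique:
  assumes "GDERIV \<phi> u :> d" "GDERIV \<phi> u :> e"
  shows "d = e"
proof -
  have "(\<lambda>h. h \<bullet> d) = (\<lambda>h. h \<bullet> e)"
    using assms unfolding gderiv_def by (rule has_derivative_unique)
  then show ?thesis
    by (simp add: fun_eq_iff vector_eq_ldot)
qed

text \<open>A linear functional is the inner product with the vector of its values on the basis, so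
  every derivative has a representing vector. Uniqueness of that vector makes the definite
  description in \<open>grad\<close> denote it.\<close>

lemma gderiv_grad:
  fixes \<phi> :: "'a::euclidean_space \<Rightarrow> real"
  assumes "\<phi> differentiable (at u)"
  shows "GDERIV \<phi> u :> grad \<phi> u"
proof -
  obtain D where D: "(\<phi> has_derivative D) (at u)"
    using assms by (auto simp: differentiable_def)
  then interpret D: linear D
    by (rule has_derivative_linear)
  have "D h = h \<bullet> (\<Sum>b\<in>Basis. D b *\<^sub>R b)" for h
  proof -
    have "D h = D (\<Sum>b\<in>Basis. (h \<bullet> b) *\<^sub>R b)"
      by (simp add: euclidean_representation)
    also have "\<dots> = (\<Sum>b\<in>Basis. (h \<bullet> b) * D b)"
      by (simp add: D.sum D.scaleR)
    also have "\<dots> = h \<bullet> (\<Sum>b\<in>Basis. D b *\<^sub>R b)"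
      by (simp add: inner_sum_right mult.commute)
    finally show ?thesis .
  qed
  then have "D = (\<lambda>h. h \<bullet> (\<Sum>b\<in>Basis. D b *\<^sub>R b))"
    by blast
  with D have ex: "GDERIV \<phi> u :> (\<Sum>b\<in>Basis. D b *\<^sub>R b)"
    by (simp add: gderiv_def)
  then show ?thesis
    unfolding grad_def by (rule theI) (rule gderiv_unique[OF _ ex])
qed

lemma grad_unique:
  fixes \<phi> :: "'a::euclidean_space \<Rightarrow> real"
  assumes "GDERIV \<phi> u :> d"
  shows "grad \<phi> u = d"
  using assms
  by (intro gderiv_unique[OF gderiv_grad]) (auto simp: gderiv_def differentiable_def)

lemma grad_uminus:
  fixes \<phi> :: "'a::euclidean_space \<Rightarrow> real"
  assumes "\<phi> differentiable (at u)"
  shows "grad (\<lambda>u. - \<phi> u) u = - grad \<phi> u"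
  by (intro grad_unique GDERIV_minus gderiv_grad assms)

lemma grad_eq_0_at_min:
  fixes \<phi> :: "'a::euclidean_space \<Rightarrow> real"
  assumes "\<phi> differentiable (at u)" "\<And>v. \<phi> u \<le> \<phi> v"
  shows "grad \<phi> u = 0"
proof -
  have "(\<lambda>h. h \<bullet> grad \<phi> u) = (\<lambda>h. 0)"
    using gderiv_grad[OF assms(1)] assms(2) unfolding gderiv_def
    by (intro has_derivative_local_min) auto
  then show ?thesis
    by (metis inner_eq_zero_iff)
qed

text \<open>Adding the strong convexity inequalities from \<open>0\<close> to \<open>u\<close> and
  back cancels the values of \<open>\<phi>\<close> and leaves strong monotonicity of the gradient;
  Cauchy-Schwarz compares this with the Lipschitz bound. A nonzero \<open>u\<close> exists because
  the basis is nonempty.\<close>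

lemma strongly_convex_smooth_le:
  fixes \<phi> :: "'a::euclidean_space \<Rightarrow> real"
  assumes "strongly_convex \<nu> \<phi>" "smooth l \<phi>"
  shows "\<nu> \<le> l"
proof -
  obtain u :: 'a where u: "u \<noteq> 0"
    using nonzero_Basis nonempty_Basis by blast
  let ?d = "grad \<phi> u - grad \<phi> 0"
  have "\<nu> / 2 * (norm u)\<^sup>2 \<le> \<phi> u - \<phi> 0 - grad \<phi> 0 \<bullet> u"
    using assms(1) unfolding strongly_convex_def by (metis diff_zero)
  moreover have "\<nu> / 2 * (norm u)\<^sup>2 \<le> \<phi> 0 - \<phi> u + grad \<phi> u \<bullet> u"
    using assms(1)[unfolded strongly_convex_def, rule_format, of 0 u] by simp
  ultimately have "\<nu> * (norm u)\<^sup>2 \<le> ?d \<bullet> u"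
    by (simp add: inner_diff_left)
  also have "\<dots> \<le> norm ?d * norm u"
    by (rule norm_cauchy_schwarz)
  also have "\<dots> \<le> (l * norm (u - 0)) * norm u"
    using assms(2)[unfolded smooth_def, rule_format, of u 0]
    by (intro mult_right_mono norm_ge_zero)
  finally show ?thesis
    using u by (simp add: power2_eq_square)
qed

lemma norm_prod_sq: "(norm z)\<^sup>2 = (norm (fst z))\<^sup>2 + (norm (snd z))\<^sup>2"
  by (simp add: norm_prod_def)


section \<open>The descent-ascent field\<close>

text \<open>The minus sign turns ascent in \<open>y\<close> into descent: the exact simultaneous
  step is \<open>z - \<alpha> *\<^sub>R gda_field f z\<close>, and convexity-concavity becomes
  monotonicity of the field.\<close>

definition gda_field ::
  "('a::real_inner \<times> 'b::real_inner \<Rightarrow> real) \<Rightarrow> 'a \<times> 'b \<Rightarrow> 'a \<times> 'b" where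
  "gda_field f z = (grad_x f z, - grad_y f z)"

text \<open>One modulus and one Lipschitz constant serve both blocks and the cross terms, so that
  all estimates can be made for \<open>z\<close> as a whole. The theorem takes the minimum of the
  moduli and the maximum of the Lipschitz constants.\<close>

locale smooth_saddle =
  fixes f :: "'a::euclidean_space \<times> 'b::euclidean_space \<Rightarrow> real"
    and \<mu> L :: real and zs :: "'a \<times> 'b"
  assumes diff: "f differentiable (at z)"
    and \<mu>_pos: "\<mu> > 0"
    and convex: "strongly_convex \<mu> (\<lambda>x. f (x, y))"
    and concave: "strongly_concave \<mu> (\<lambda>y. f (x, y))"
    and smooth_x: "smooth L (\<lambda>x. f (x, y))"
    and smooth_y: "smooth L (\<lambda>y. f (x, y))"
    and lip_xy: "norm (grad_x f (x, y) - grad_x f (x, y')) \<le> L * norm (y - y')"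
    and lip_yx: "norm (grad_y f (x, y) - grad_y f (x', y)) \<le> L * norm (x - x')"
    and saddle: "saddle_point f zs"
begin

lemma \<mu>_le_L: "\<mu> \<le> L"
  using convex smooth_x by (rule strongly_convex_smooth_le)

lemma L_pos: "L > 0"
  using \<mu>_pos \<mu>_le_L by simp

lemma diff_x: "(\<lambda>x. f (x, y)) differentiable (at x)"
  and diff_y: "(\<lambda>y. f (x, y)) differentiable (at y)"
proof -
  obtain D where D: "(f has_derivative D) (at (x, y))"
    using diff by (auto simp: differentiable_def)
  have "((\<lambda>x. f (x, y)) has_derivative (\<lambda>h. D (h, 0))) (at x)"
    by (rule has_derivative_compose[of "\<lambda>x. (x, y)" "\<lambda>h. (h, 0)"])
      (auto intro!: derivative_eq_intros D)
  then show "(\<lambda>x. f (x, y)) differentiable (at x)"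
    by (auto simp: differentiable_def)
  have "((\<lambda>y. f (x, y)) has_derivative (\<lambda>h. D (0, h))) (at y)"
    by (rule has_derivative_compose[of "\<lambda>y. (x, y)" "\<lambda>h. (0, h)"])
      (auto intro!: derivative_eq_intros D)
  then show "(\<lambda>y. f (x, y)) differentiable (at y)"
    by (auto simp: differentiable_def)
qed

lemma convex_ge:
  "f (x, y) + grad_x f (x, y) \<bullet> (x' - x) + \<mu> / 2 * (norm (x' - x))\<^sup>2 \<le> f (x', y)"
  using convex[of y, unfolded strongly_convex_def, rule_format, of x' x]
  by (simp add: grad_x_def)

lemma concave_le:
  "f (x, y') \<le> f (x, y) + grad_y f (x, y) \<bullet> (y' - y) - \<mu> / 2 * (norm (y' - y))\<^sup>2"
  using concave[of x, unfolded strongly_concave_def strongly_convex_def, rule_format, of y' y]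
  by (simp add: grad_y_def grad_uminus[OF diff_y])

text \<open>The two halves of the saddle inequality say that \<open>fst zs\<close> minimises
  \<open>f\<close> with the second block fixed and \<open>snd zs\<close> minimises
  \<open>- f\<close> with the first block fixed.\<close>

lemma grad_saddle: "grad_x f zs = 0" "grad_y f zs = 0"
proof -
  show "grad_x f zs = 0"
    unfolding grad_x_def using saddle
    by (intro grad_eq_0_at_min diff_x) (auto simp: saddle_point_def)
  have "grad (\<lambda>y. - f (fst zs, y)) (snd zs) = 0"
    using saddle
    by (intro grad_eq_0_at_min differentiable_minus diff_y) (auto simp: saddle_point_def)
  then show "grad_y f zs = 0"
    by (simp add: grad_uminus[OF diff_y] grad_y_def)
qed

lemma gda_field_saddle: "gda_field f zs = 0"
  by (simp add: gda_field_def grad_saddle zero_prod_def)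

text \<open>Four inequalities are added: strong convexity and concavity based at \<open>z\<close>,
  and the same two based at \<open>zs\<close>, where the gradient terms vanish. The values of
  \<open>f\<close> at the four corners cancel. Each block distance occurs twice with weight
  \<open>\<mu> / 2\<close>, which yields the full modulus \<open>\<mu>\<close>.\<close>

lemma gda_field_monotone: "\<mu> * (norm (z - zs))\<^sup>2 \<le> gda_field f z \<bullet> (z - zs)"
proof -
  obtain x y xs ys where z: "z = (x, y)" "zs = (xs, ys)"
    by (meson surj_pair)
  note g = grad_saddle[unfolded z]
  have "f (x, y) + grad_x f (x, y) \<bullet> (xs - x) + \<mu> / 2 * (norm (xs - x))\<^sup>2 \<le> f (xs, y)"
    by (rule convex_ge)
  moreover have "f (x, ys) \<le> f (x, y) + grad_y f (x, y) \<bullet> (ys - y) - \<mu> / 2 * (norm (ys - y))\<^sup>2"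
    by (rule concave_le)
  moreover have "f (xs, ys) + \<mu> / 2 * (norm (x - xs))\<^sup>2 \<le> f (x, ys)"
    using convex_ge[of xs ys x] g by simp
  moreover have "f (xs, y) \<le> f (xs, ys) - \<mu> / 2 * (norm (y - ys))\<^sup>2"
    using concave_le[of xs y ys] g by simp
  ultimately show ?thesis
    by (simp add: z gda_field_def norm_prod_sq norm_minus_commute inner_diff_right algebra_simps)
qed

text \<open>The arguments are changed one at a time through the corner
  \<open>(fst z, snd w)\<close>: the cross-Lipschitz bound covers the change in \<open>y\<close>,
  smoothness the change in \<open>x\<close>.\<close>

lemma grad_x_lip: "norm (grad_x f z - grad_x f w) \<le> L * (norm (fst z - fst w) + norm (snd z - snd w))"
proof -
  have "norm (grad_x f z - grad_x f w)
      \<le> norm (grad_x f (fst z, snd z) - grad_x f (fst z, snd w))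
        + norm (grad_x f (fst z, snd w) - grad_x f (fst w, snd w))"
    using norm_triangle_ineq[of "grad_x f (fst z, snd z) - grad_x f (fst z, snd w)"
        "grad_x f (fst z, snd w) - grad_x f (fst w, snd w)"] by simp
  also have "\<dots> \<le> L * norm (snd z - snd w) + L * norm (fst z - fst w)"
    using smooth_x[of "snd w"] by (intro add_mono lip_xy) (auto simp: smooth_def grad_x_def)
  finally show ?thesis
    by (simp add: algebra_simps)
qed

lemma grad_y_lip: "norm (grad_y f z - grad_y f w) \<le> L * (norm (fst z - fst w) + norm (snd z - snd w))"
proof -
  have "norm (grad_y f z - grad_y f w)
      \<le> norm (grad_y f (fst z, snd z) - grad_y f (fst w, snd z))
        + norm (grad_y f (fst w, snd z) - grad_y f (fst w, snd w))"
    using norm_triangle_ineq[of "grad_y f (fst z, snd z) - grad_y f (fst w, snd z)"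
        "grad_y f (fst w, snd z) - grad_y f (fst w, snd w)"] by simp
  also have "\<dots> \<le> L * norm (fst z - fst w) + L * norm (snd z - snd w)"
    using smooth_y[of "fst w"] by (intro add_mono lip_yx) (auto simp: smooth_def grad_y_def)
  finally show ?thesis
    by (simp add: algebra_simps)
qed

text \<open>One factor 2 of the constant counts the two blocks; the other comes from
  \<open>(s + t)\<^sup>2 \<le> 2 * (s\<^sup>2 + t\<^sup>2)\<close>, that is, from
  \<open>(s - t)\<^sup>2 \<ge> 0\<close>.\<close>

lemma gda_field_lip: "(norm (gda_field f z - gda_field f w))\<^sup>2 \<le> 4 * L\<^sup>2 * (norm (z - w))\<^sup>2"
proof -
  let ?s = "norm (fst z - fst w)" and ?t = "norm (snd z - snd w)"
  have "(norm (grad_x f z - grad_x f w))\<^sup>2 \<le> (L * (?s + ?t))\<^sup>2"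
       "(norm (grad_y f z - grad_y f w))\<^sup>2 \<le> (L * (?s + ?t))\<^sup>2"
    by (intro power_mono grad_x_lip grad_y_lip norm_ge_zero)+
  moreover have "norm (- grad_y f z + grad_y f w) = norm (grad_y f z - grad_y f w)"
    by (metis minus_diff_eq norm_minus_cancel uminus_add_conv_diff diff_conv_add_uminus add.commute)
  ultimately have "(norm (gda_field f z - gda_field f w))\<^sup>2 \<le> 2 * (L * (?s + ?t))\<^sup>2"
    by (simp add: norm_prod_sq gda_field_def)
  also have "\<dots> = 2 * L\<^sup>2 * (?s + ?t)\<^sup>2"
    by (simp add: power_mult_distrib)
  also have "\<dots> \<le> 2 * L\<^sup>2 * (2 * (?s\<^sup>2 + ?t\<^sup>2))"
    using sum_squares_ge_zero[of "?s - ?t" 0]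
    by (intro mult_left_mono) (auto simp: power2_eq_square algebra_simps)
  finally show ?thesis
    by (simp add: norm_prod_sq[of "z - w"] algebra_simps)
qed

text \<open>In the expanded square, monotonicity gains \<open>2 * \<alpha> * \<mu>\<close> times the
  squared distance. Since the field vanishes at \<open>zs\<close>, its square is bounded by the
  Lipschitz estimate, and the stepsize condition makes that term cost at most half of the
  gain.\<close>

lemma gda_step_contraction:
  assumes "0 \<le> \<alpha>" "4 * L\<^sup>2 * \<alpha> \<le> \<mu>"
  shows "(norm (z - \<alpha> *\<^sub>R gda_field f z - zs))\<^sup>2 \<le> (1 - \<alpha> * \<mu>) * (norm (z - zs))\<^sup>2"
proof -
  let ?F = "gda_field f z" and ?r = "(norm (z - zs))\<^sup>2"
  have "(norm (z - \<alpha> *\<^sub>R ?F - zs))\<^sup>2 = ?r - 2 * \<alpha> * (?F \<bullet> (z - zs)) + \<alpha>\<^sup>2 * (norm ?F)\<^sup>2"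
    unfolding power2_norm_eq_inner
    by (simp add: inner_diff_left inner_diff_right inner_commute power2_eq_square algebra_simps)
  also have "\<dots> \<le> ?r - 2 * \<alpha> * (\<mu> * ?r) + \<alpha>\<^sup>2 * (4 * L\<^sup>2 * ?r)"
    using gda_field_lip[of z zs] assms
    by (intro add_mono diff_mono mult_left_mono gda_field_monotone) (auto simp: gda_field_saddle)
  also have "\<alpha>\<^sup>2 * (4 * L\<^sup>2 * ?r) = \<alpha> * ?r * (4 * L\<^sup>2 * \<alpha>)"
    by (simp add: power2_eq_square)
  also have "\<dots> \<le> \<alpha> * ?r * \<mu>"
    using assms by (intro mult_left_mono) auto
  finally show ?thesis
    by (simp add: algebra_simps)
qed

text \<open>This makes the partial gradients Borel functions, so that their values at an iterate are
  measurable for the sigma-algebra generated by that iterate.\<close>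

lemma continuous_grad: "continuous_on UNIV (grad_x f)" "continuous_on UNIV (grad_y f)"
proof -
  have le: "L * (norm (fst z - fst w) + norm (snd z - snd w)) \<le> 2 * L * dist z w" for z w :: "'a \<times> 'b"
    using L_pos norm_fst_le[of "fst z - fst w" "snd z - snd w"]
      norm_snd_le[of "snd z - snd w" "fst z - fst w"]
    by (simp add: dist_norm minus_prod_def)
  have "(2 * L)-lipschitz_on UNIV (grad_x f)"
    using L_pos by (intro lipschitz_onI) (auto simp: dist_norm[of "grad_x f _"] intro: order_trans[OF grad_x_lip le])
  then show "continuous_on UNIV (grad_x f)"
    by (rule lipschitz_on_continuous_on)
  have "(2 * L)-lipschitz_on UNIV (grad_y f)"
    using L_pos by (intro lipschitz_onI) (auto simp: dist_norm[of "grad_y f _"] intro: order_trans[OF grad_y_lip le])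
  then show "continuous_on UNIV (grad_y f)"
    by (rule lipschitz_on_continuous_on)
qed

end


section \<open>Unbiased noise\<close>

lemma (in prob_space) integrable_norm_mult_norm:
  fixes V N :: "'a \<Rightarrow> 'v::euclidean_space"
  assumes [measurable]: "V \<in> borel_measurable M" "N \<in> borel_measurable M"
    and "integrable M (\<lambda>\<omega>. (norm (V \<omega>))\<^sup>2)" "integrable M (\<lambda>\<omega>. (norm (N \<omega>))\<^sup>2)"
  shows "integrable M (\<lambda>\<omega>. norm (V \<omega>) * norm (N \<omega>))"
proof (rule Bochner_Integration.integrable_bound)
  show "integrable M (\<lambda>\<omega>. (norm (V \<omega>))\<^sup>2 + (norm (N \<omega>))\<^sup>2)"
    using assms by simp
  have "a * b \<le> a\<^sup>2 + b\<^sup>2" if "a \<ge> 0" "b \<ge> 0" for a b :: real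
    using sum_squares_bound[of a b] that mult_nonneg_nonneg[OF that] by linarith
  then show "AE \<omega> in M. norm (norm (V \<omega>) * norm (N \<omega>)) \<le> norm ((norm (V \<omega>))\<^sup>2 + (norm (N \<omega>))\<^sup>2)"
    by simp
qed simp

text \<open>\<open>cond_mean\<close> speaks of coordinates, so the inner product is expanded over
  the basis. Each coordinate of \<open>V\<close> is \<open>F\<close>-measurable and multiplies the
  coordinate of \<open>X - Y\<close>, which may therefore be replaced by its conditional
  expectation, namely 0.\<close>

lemma (in prob_space) expectation_inner_cond_mean:
  fixes X Y V :: "'a \<Rightarrow> 'v::euclidean_space"
  assumes F: "subalgebra M F"
    and mean: "cond_mean M F X Y"
    and V [measurable]: "V \<in> borel_measurable F" and Y [measurable]: "Y \<in> borel_measurable F"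
    and V2: "integrable M (\<lambda>\<omega>. (norm (V \<omega>))\<^sup>2)"
    and N2: "integrable M (\<lambda>\<omega>. (norm (X \<omega> - Y \<omega>))\<^sup>2)"
  shows "integrable M (\<lambda>\<omega>. V \<omega> \<bullet> (X \<omega> - Y \<omega>))" "expectation (\<lambda>\<omega>. V \<omega> \<bullet> (X \<omega> - Y \<omega>)) = 0"
proof -
  interpret F: finite_measure_subalgebra M F
    by unfold_locales (rule F)
  have X: "integrable M X"
    using mean by (simp add: cond_mean_def)
  note [measurable] = borel_measurable_integrable[OF X]
    measurable_from_subalg[OF F V] measurable_from_subalg[OF F Y]
  \<comment> \<open>Splitting the conditional expectation of \<open>X - Y\<close> requires
    \<open>Y\<close> integrable. The noise is square integrable, hence integrable on a probability
    space, and \<open>Y\<close> is \<open>X\<close> minus the noise.\<close>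
  have "integrable M (\<lambda>\<omega>. norm (X \<omega> - Y \<omega>))"
    by (rule square_integrable_imp_integrable[OF _ N2]) measurable
  then have N: "integrable M (\<lambda>\<omega>. X \<omega> - Y \<omega>)"
    by (subst (asm) integrable_norm_iff) measurable
  have "integrable M (\<lambda>\<omega>. X \<omega> - (X \<omega> - Y \<omega>))"
    using X N by (rule Bochner_Integration.integrable_diff)
  then have Yi: "integrable M Y"
    by simp
  have VN: "integrable M (\<lambda>\<omega>. norm (V \<omega>) * norm (X \<omega> - Y \<omega>))"
    using V2 N2 by (intro integrable_norm_mult_norm) auto
  have b: "integrable M (\<lambda>\<omega>. (V \<omega> \<bullet> b) * ((X \<omega> - Y \<omega>) \<bullet> b)) \<and>
      expectation (\<lambda>\<omega>. (V \<omega> \<bullet> b) * ((X \<omega> - Y \<omega>) \<bullet> b)) = 0" if b: "b \<in> Basis" for b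
  proof
    have "\<bar>(V \<omega> \<bullet> b) * ((X \<omega> - Y \<omega>) \<bullet> b)\<bar> \<le> norm (V \<omega>) * norm (X \<omega> - Y \<omega>)" for \<omega>
      unfolding abs_mult using b by (intro mult_mono Basis_le_norm) auto
    then show int: "integrable M (\<lambda>\<omega>. (V \<omega> \<bullet> b) * ((X \<omega> - Y \<omega>) \<bullet> b))"
      by (intro Bochner_Integration.integrable_bound[OF VN]) auto
    have "AE \<omega> in M. real_cond_exp M F (\<lambda>\<omega>. X \<omega> \<bullet> b) \<omega> = Y \<omega> \<bullet> b"
      using mean b by (simp add: cond_mean_def)
    moreover have "AE \<omega> in M. real_cond_exp M F (\<lambda>\<omega>. Y \<omega> \<bullet> b) \<omega> = Y \<omega> \<bullet> b"
      using Yi by (intro F.real_cond_exp_F_meas) auto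
    moreover have "AE \<omega> in M. real_cond_exp M F (\<lambda>\<omega>. X \<omega> \<bullet> b - Y \<omega> \<bullet> b) \<omega>
        = real_cond_exp M F (\<lambda>\<omega>. X \<omega> \<bullet> b) \<omega> - real_cond_exp M F (\<lambda>\<omega>. Y \<omega> \<bullet> b) \<omega>"
      using X Yi by (intro F.real_cond_exp_diff) auto
    ultimately have 0: "AE \<omega> in M. real_cond_exp M F (\<lambda>\<omega>. (X \<omega> - Y \<omega>) \<bullet> b) \<omega> = 0"
      by eventually_elim (simp add: inner_diff_left)
    have "expectation (\<lambda>\<omega>. (V \<omega> \<bullet> b) * ((X \<omega> - Y \<omega>) \<bullet> b))
        = expectation (\<lambda>\<omega>. (V \<omega> \<bullet> b) * real_cond_exp M F (\<lambda>\<omega>. (X \<omega> - Y \<omega>) \<bullet> b) \<omega>)"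
      using int by (intro F.real_cond_exp_intg(2)[symmetric]) auto
    also have "\<dots> = 0"
      using 0 by (intro integral_eq_zero_AE) (auto elim: eventually_mono)
    finally show "expectation (\<lambda>\<omega>. (V \<omega> \<bullet> b) * ((X \<omega> - Y \<omega>) \<bullet> b)) = 0" .
  qed
  have eq: "V \<omega> \<bullet> (X \<omega> - Y \<omega>) = (\<Sum>b\<in>Basis. (V \<omega> \<bullet> b) * ((X \<omega> - Y \<omega>) \<bullet> b))" for \<omega>
    by (rule euclidean_inner)
  show "integrable M (\<lambda>\<omega>. V \<omega> \<bullet> (X \<omega> - Y \<omega>))"
    unfolding eq using b by (intro Bochner_Integration.integrable_sum) auto
  show "expectation (\<lambda>\<omega>. V \<omega> \<bullet> (X \<omega> - Y \<omega>)) = 0"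
    unfolding eq using b by (subst Bochner_Integration.integral_sum) auto
qed

text \<open>This is the tower property, obtained by testing against the constant 1. It is carried
  out with extended nonnegative integrals, so that integrability is a consequence of the finite
  bound.\<close>

lemma (in prob_space) expectation_le_nn_cond_exp_bound:
  fixes g :: "'a \<Rightarrow> real"
  assumes F: "subalgebra M F" and [measurable]: "g \<in> borel_measurable M"
    and nonneg: "\<And>\<omega>. 0 \<le> g \<omega>" and c: "0 \<le> c"
    and bound: "AE \<omega> in M. nn_cond_exp M F (\<lambda>\<omega>. ennreal (g \<omega>)) \<omega> \<le> ennreal c"
  shows "integrable M g" "expectation g \<le> c"
proof -
  interpret F: finite_measure_subalgebra M F
    by unfold_locales (rule F)
  have "(\<integral>\<^sup>+\<omega>. ennreal (g \<omega>) \<partial>M) = (\<integral>\<^sup>+\<omega>. nn_cond_exp M F (\<lambda>\<omega>. ennreal (g \<omega>)) \<omega> \<partial>M)"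
    using F.nn_cond_exp_intg[of "\<lambda>_. 1" "\<lambda>\<omega>. ennreal (g \<omega>)"] by simp
  also have "\<dots> \<le> (\<integral>\<^sup>+\<omega>. ennreal c \<partial>M)"
    using bound by (rule nn_integral_mono_AE)
  also have "\<dots> = ennreal c"
    by (simp add: emeasure_space_1)
  finally have le: "(\<integral>\<^sup>+\<omega>. ennreal (g \<omega>) \<partial>M) \<le> ennreal c" .
  then show int: "integrable M g"
    using nonneg by (intro integrableI_nonneg) (auto simp: le_less_trans ennreal_less_top)
  show "expectation g \<le> c"
    using le c nonneg by (simp add: nn_integral_eq_integral[OF int])
qed

text \<open>In the expanded square the cross term has mean 0, because \<open>V\<close> is known
  given \<open>F\<close> and the noise is centred.\<close>

lemma (in prob_space) expectation_sq_add_noise: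
  fixes X Y V :: "'a \<Rightarrow> 'v::euclidean_space"
  assumes F: "subalgebra M F"
    and mean: "cond_mean M F X Y"
    and var: "AE \<omega> in M. nn_cond_exp M F (\<lambda>\<omega>. ennreal ((norm (X \<omega> - Y \<omega>))\<^sup>2)) \<omega> \<le> ennreal (\<sigma>\<^sup>2)"
    and V [measurable]: "V \<in> borel_measurable F" and Y [measurable]: "Y \<in> borel_measurable F"
    and V2: "integrable M (\<lambda>\<omega>. (norm (V \<omega>))\<^sup>2)"
  shows "integrable M (\<lambda>\<omega>. (norm (V \<omega> + c *\<^sub>R (X \<omega> - Y \<omega>)))\<^sup>2)"
    and "expectation (\<lambda>\<omega>. (norm (V \<omega> + c *\<^sub>R (X \<omega> - Y \<omega>)))\<^sup>2)
      \<le> expectation (\<lambda>\<omega>. (norm (V \<omega>))\<^sup>2) + c\<^sup>2 * \<sigma>\<^sup>2"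
proof -
  have [measurable]: "X \<in> borel_measurable M" "Y \<in> borel_measurable M"
    using mean by (auto simp: cond_mean_def intro: measurable_from_subalg[OF F Y])
  have N2: "integrable M (\<lambda>\<omega>. (norm (X \<omega> - Y \<omega>))\<^sup>2)"
      "expectation (\<lambda>\<omega>. (norm (X \<omega> - Y \<omega>))\<^sup>2) \<le> \<sigma>\<^sup>2"
    by (rule expectation_le_nn_cond_exp_bound[OF F _ _ _ var]; simp)+
  note cross = expectation_inner_cond_mean[OF F mean V Y V2 N2(1)]
  have eq: "(norm (V \<omega> + c *\<^sub>R (X \<omega> - Y \<omega>)))\<^sup>2
      = (norm (V \<omega>))\<^sup>2 + 2 * c * (V \<omega> \<bullet> (X \<omega> - Y \<omega>)) + c\<^sup>2 * (norm (X \<omega> - Y \<omega>))\<^sup>2" for \<omega>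
    unfolding power2_norm_eq_inner
    by (simp add: inner_add_left inner_add_right inner_commute power2_eq_square algebra_simps)
  show "integrable M (\<lambda>\<omega>. (norm (V \<omega> + c *\<^sub>R (X \<omega> - Y \<omega>)))\<^sup>2)"
    unfolding eq using V2 N2 cross by auto
  have "expectation (\<lambda>\<omega>. (norm (V \<omega> + c *\<^sub>R (X \<omega> - Y \<omega>)))\<^sup>2)
      = expectation (\<lambda>\<omega>. (norm (V \<omega>))\<^sup>2) + c\<^sup>2 * expectation (\<lambda>\<omega>. (norm (X \<omega> - Y \<omega>))\<^sup>2)"
    unfolding eq using V2 N2 cross by simp
  also have "\<dots> \<le> expectation (\<lambda>\<omega>. (norm (V \<omega>))\<^sup>2) + c\<^sup>2 * \<sigma>\<^sup>2"
    using N2 by (intro add_left_mono mult_left_mono) auto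
  finally show "expectation (\<lambda>\<omega>. (norm (V \<omega> + c *\<^sub>R (X \<omega> - Y \<omega>)))\<^sup>2)
      \<le> expectation (\<lambda>\<omega>. (norm (V \<omega>))\<^sup>2) + c\<^sup>2 * \<sigma>\<^sup>2" .
qed

section \<open>Generated sigma-algebras and one stochastic step\<close>

lemma subalgebra_generated:
  assumes "X \<in> measurable M N"
  shows "subalgebra M (generated M N X)"
  unfolding subalgebra_def generated_def
  using assms by (auto simp: sets_vimage_algebra2 measurable_space intro: measurable_sets)

lemma measurable_generated:
  assumes "X \<in> measurable M N"
  shows "X \<in> measurable (generated M N X) N"
  unfolding generated_def using assms
  by (intro measurable_vimage_algebra1) (auto dest: measurable_space)

lemma
  fixes W :: "'w \<Rightarrow> 'a::topological_space \<times> 'b::topological_space"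
  assumes "W \<in> borel_measurable N"
  shows borel_measurable_fst: "(\<lambda>\<omega>. fst (W \<omega>)) \<in> borel_measurable N"
    and borel_measurable_snd: "(\<lambda>\<omega>. snd (W \<omega>)) \<in> borel_measurable N"
  by (rule measurable_compose[OF assms borel_measurable_continuous_onI], intro continuous_intros)+

text \<open>The squared norm splits over the two blocks, and each block is its part of the exact
  step plus centred noise. The noise is estimated block by block, each contributing
  \<open>\<alpha>\<^sup>2 * \<sigma>\<^sup>2\<close>; the exact parts are then put together again so
  that the contraction applies.\<close>

lemma (in smooth_saddle) expectation_stochastic_step:
  fixes M :: "'w measure" and W :: "'w \<Rightarrow> 'a \<times> 'b"
  defines "F \<equiv> generated M borel W"
  assumes "prob_space M"
    and W [measurable]: "W \<in> borel_measurable M"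
    and W2: "integrable M (\<lambda>\<omega>. (norm (W \<omega> - zs))\<^sup>2)"
    and X: "cond_mean M F X (\<lambda>\<omega>. grad_x f (W \<omega>))"
      "AE \<omega> in M. nn_cond_exp M F (\<lambda>\<omega>. ennreal ((norm (X \<omega> - grad_x f (W \<omega>)))\<^sup>2)) \<omega> \<le> ennreal (\<sigma>\<^sup>2)"
    and Y: "cond_mean M F Y (\<lambda>\<omega>. grad_y f (W \<omega>))"
      "AE \<omega> in M. nn_cond_exp M F (\<lambda>\<omega>. ennreal ((norm (Y \<omega> - grad_y f (W \<omega>)))\<^sup>2)) \<omega> \<le> ennreal (\<sigma>\<^sup>2)"
    and \<alpha>: "0 \<le> \<alpha>" "4 * L\<^sup>2 * \<alpha> \<le> \<mu>"
  defines "W' \<equiv> \<lambda>\<omega>. (fst (W \<omega>) - \<alpha> *\<^sub>R X \<omega>, snd (W \<omega>) + \<alpha> *\<^sub>R Y \<omega>)"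
  shows "integrable M (\<lambda>\<omega>. (norm (W' \<omega> - zs))\<^sup>2)"
    and "prob_space.expectation M (\<lambda>\<omega>. (norm (W' \<omega> - zs))\<^sup>2)
      \<le> (1 - \<alpha> * \<mu>) * prob_space.expectation M (\<lambda>\<omega>. (norm (W \<omega> - zs))\<^sup>2) + 2 * \<alpha>\<^sup>2 * \<sigma>\<^sup>2"
proof -
  interpret prob_space M by fact
  have F: "subalgebra M F"
    unfolding F_def by (rule subalgebra_generated) fact
  have WF [measurable]: "W \<in> borel_measurable F"
    unfolding F_def by (rule measurable_generated) fact
  have [measurable]: "grad_x f \<in> borel_measurable borel" "grad_y f \<in> borel_measurable borel"
    by (intro borel_measurable_continuous_onI continuous_grad)+
  note [measurable] = borel_measurable_fst[OF WF] borel_measurable_snd[OF WF]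
  \<comment> \<open>The error after an exact step. It is a function of \<open>W\<close> alone, hence
    measurable for \<open>F\<close>.\<close>
  define V where "V = (\<lambda>\<omega>. W \<omega> - \<alpha> *\<^sub>R gda_field f (W \<omega>) - zs)"
  have Vx: "fst (V \<omega>) = fst (W \<omega>) - \<alpha> *\<^sub>R grad_x f (W \<omega>) - fst zs"
    and Vy: "snd (V \<omega>) = snd (W \<omega>) + \<alpha> *\<^sub>R grad_y f (W \<omega>) - snd zs" for \<omega>
    by (simp_all add: V_def gda_field_def)
  have [measurable]: "(\<lambda>\<omega>. fst (V \<omega>)) \<in> borel_measurable F" "(\<lambda>\<omega>. snd (V \<omega>)) \<in> borel_measurable F"
    unfolding Vx Vy by measurable
  have [measurable]: "(\<lambda>\<omega>. fst (V \<omega>)) \<in> borel_measurable M" "(\<lambda>\<omega>. snd (V \<omega>)) \<in> borel_measurable M"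
    by (auto intro: measurable_from_subalg[OF F])
  have Vle: "(norm (fst (V \<omega>)))\<^sup>2 + (norm (snd (V \<omega>)))\<^sup>2 \<le> (1 - \<alpha> * \<mu>) * (norm (W \<omega> - zs))\<^sup>2" for \<omega>
    unfolding norm_prod_sq[symmetric] V_def by (rule gda_step_contraction[OF \<alpha>])
  have W2': "integrable M (\<lambda>\<omega>. (1 - \<alpha> * \<mu>) * (norm (W \<omega> - zs))\<^sup>2)"
    using W2 by simp
  have V2: "integrable M (\<lambda>\<omega>. (norm (fst (V \<omega>)))\<^sup>2)" "integrable M (\<lambda>\<omega>. (norm (snd (V \<omega>)))\<^sup>2)"
  proof -
    have "(norm (fst (V \<omega>)))\<^sup>2 \<le> (1 - \<alpha> * \<mu>) * (norm (W \<omega> - zs))\<^sup>2"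
      "(norm (snd (V \<omega>)))\<^sup>2 \<le> (1 - \<alpha> * \<mu>) * (norm (W \<omega> - zs))\<^sup>2" for \<omega>
      using Vle[of \<omega>] zero_le_power2[of "norm (fst (V \<omega>))"] zero_le_power2[of "norm (snd (V \<omega>))"]
      by linarith+
    then show "integrable M (\<lambda>\<omega>. (norm (fst (V \<omega>)))\<^sup>2)" "integrable M (\<lambda>\<omega>. (norm (snd (V \<omega>)))\<^sup>2)"
      by (intro Bochner_Integration.integrable_bound[OF W2']; auto intro: order_trans[OF _ abs_ge_self])+
  qed
  \<comment> \<open>The noise enters the descent block with coefficient \<open>- \<alpha>\<close>
    and the ascent block with \<open>\<alpha>\<close>; the bounds contain only the square.\<close>
  note x = expectation_sq_add_noise[OF F X _ _ V2(1), of "- \<alpha>"]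
  note y = expectation_sq_add_noise[OF F Y _ _ V2(2), of \<alpha>]
  have eq: "(norm (W' \<omega> - zs))\<^sup>2 = (norm (fst (V \<omega>) + (- \<alpha>) *\<^sub>R (X \<omega> - grad_x f (W \<omega>))))\<^sup>2
      + (norm (snd (V \<omega>) + \<alpha> *\<^sub>R (Y \<omega> - grad_y f (W \<omega>))))\<^sup>2" for \<omega>
    by (simp add: norm_prod_sq W'_def Vx Vy algebra_simps)
  show "integrable M (\<lambda>\<omega>. (norm (W' \<omega> - zs))\<^sup>2)"
    unfolding eq by (intro Bochner_Integration.integrable_add x y) measurable
  have "expectation (\<lambda>\<omega>. (norm (W' \<omega> - zs))\<^sup>2)
      = expectation (\<lambda>\<omega>. (norm (fst (V \<omega>) + (- \<alpha>) *\<^sub>R (X \<omega> - grad_x f (W \<omega>))))\<^sup>2)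
      + expectation (\<lambda>\<omega>. (norm (snd (V \<omega>) + \<alpha> *\<^sub>R (Y \<omega> - grad_y f (W \<omega>))))\<^sup>2)"
    unfolding eq by (intro Bochner_Integration.integral_add x y) measurable
  also have "\<dots> \<le> (expectation (\<lambda>\<omega>. (norm (fst (V \<omega>)))\<^sup>2) + (- \<alpha>)\<^sup>2 * \<sigma>\<^sup>2)
      + (expectation (\<lambda>\<omega>. (norm (snd (V \<omega>)))\<^sup>2) + \<alpha>\<^sup>2 * \<sigma>\<^sup>2)"
    by (intro add_mono x y) measurable
  also have "\<dots> = expectation (\<lambda>\<omega>. (norm (fst (V \<omega>)))\<^sup>2 + (norm (snd (V \<omega>)))\<^sup>2) + 2 * \<alpha>\<^sup>2 * \<sigma>\<^sup>2"
    using V2 by simp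
  also have "\<dots> \<le> expectation (\<lambda>\<omega>. (1 - \<alpha> * \<mu>) * (norm (W \<omega> - zs))\<^sup>2) + 2 * \<alpha>\<^sup>2 * \<sigma>\<^sup>2"
    using V2 W2' Vle by (intro add_right_mono integral_mono) auto
  finally show "expectation (\<lambda>\<omega>. (norm (W' \<omega> - zs))\<^sup>2)
      \<le> (1 - \<alpha> * \<mu>) * expectation (\<lambda>\<omega>. (norm (W \<omega> - zs))\<^sup>2) + 2 * \<alpha>\<^sup>2 * \<sigma>\<^sup>2"
    by simp
qed


section \<open>Recursion over the stages\<close>

text \<open>The constant \<open>c\<close> is the fixed point of
  \<open>t \<mapsto> (1 - q) * t + q * c\<close>, so the bound \<open>(1 - q) ^ j * e 0 + c\<close>
  reproduces itself; then \<open>1 - q \<le> exp (- q)\<close>.\<close>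

lemma affine_recursion_bound:
  fixes e :: "nat \<Rightarrow> real"
  assumes step: "\<And>j. j < N \<Longrightarrow> e (Suc j) \<le> (1 - q) * e j + q * c"
    and q: "0 \<le> q" "q \<le> 1" and "0 \<le> c" "0 \<le> e 0"
  shows "e N \<le> exp (- q * real N) * e 0 + c"
proof -
  have "j \<le> N \<Longrightarrow> e j \<le> (1 - q) ^ j * e 0 + c" for j
  proof (induction j)
    case (Suc j)
    then have "e (Suc j) \<le> (1 - q) * ((1 - q) ^ j * e 0 + c) + q * c"
      using step[of j] q by (smt (verit) mult_left_mono Suc_leD Suc_le_lessD)
    then show ?case
      by (simp add: algebra_simps)
  qed (use \<open>0 \<le> c\<close> in simp)
  then have "e N \<le> (1 - q) ^ N * e 0 + c"
    by simp
  also have "(1 - q) ^ N \<le> exp (- q) ^ N"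
    using q exp_ge_add_one_self[of "- q"] by (intro power_mono) auto
  then have "(1 - q) ^ N * e 0 + c \<le> exp (- q) ^ N * e 0 + c"
    using \<open>0 \<le> e 0\<close> by (intro add_right_mono mult_right_mono)
  also have "exp (- q) ^ N = exp (- q * real N)"
    by (metis exp_of_nat_mult mult.commute)
  finally show ?thesis .
qed

lemma mgda_Suc:
  "mgda Gx Gy \<zeta> \<xi> \<alpha> n z0 (Suc k) (Suc j) =
     (\<lambda>\<omega>. (fst (mgda Gx Gy \<zeta> \<xi> \<alpha> n z0 (Suc k) j \<omega>)
             - \<alpha> (Suc k) *\<^sub>R Gx (mgda Gx Gy \<zeta> \<xi> \<alpha> n z0 (Suc k) j \<omega>) (\<zeta> (Suc k) j \<omega>),
           snd (mgda Gx Gy \<zeta> \<xi> \<alpha> n z0 (Suc k) j \<omega>)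
             + \<alpha> (Suc k) *\<^sub>R Gy (mgda Gx Gy \<zeta> \<xi> \<alpha> n z0 (Suc k) j \<omega>) (\<xi> (Suc k) j \<omega>)))"
  by (simp add: fun_eq_iff Let_def)

text \<open>The one-step estimate is iterated with \<open>q = \<alpha> (Suc k) * \<mu>\<close>.
  Measurability and square integrability of the last iterate are concluded as well, since the next
  stage starts from them.\<close>

lemma (in smooth_saddle) expectation_mgda_stage:
  fixes Z :: "nat \<Rightarrow> nat \<Rightarrow> 'w \<Rightarrow> 'a \<times> 'b"
  assumes "prob_space M"
    and Gx [measurable]: "(\<lambda>(z, s). Gx z s) \<in> measurable (borel \<Otimes>\<^sub>M S) borel"
    and Gy [measurable]: "(\<lambda>(z, t). Gy z t) \<in> measurable (borel \<Otimes>\<^sub>M T) borel"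
    and Z_def: "Z = mgda Gx Gy \<zeta> \<xi> \<alpha> n z0"
    and estimates: "\<And>j. j < n (Suc k) \<Longrightarrow> stochastic_oracle_at M f \<sigma> S T Gx Gy \<zeta> \<xi> n Z (Suc k) j"
    and \<alpha>: "0 < \<alpha> (Suc k)" "4 * L\<^sup>2 * \<alpha> (Suc k) \<le> \<mu>"
    and meas: "Z k (n k) \<in> borel_measurable M"
    and int: "integrable M (\<lambda>\<omega>. (norm (Z k (n k) \<omega> - zs))\<^sup>2)"
  shows "Z (Suc k) (n (Suc k)) \<in> borel_measurable M"
    and "integrable M (\<lambda>\<omega>. (norm (Z (Suc k) (n (Suc k)) \<omega> - zs))\<^sup>2)"
    and "prob_space.expectation M (\<lambda>\<omega>. (norm (Z (Suc k) (n (Suc k)) \<omega> - zs))\<^sup>2)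
      \<le> exp (- (\<alpha> (Suc k) * \<mu>) * real (n (Suc k)))
          * prob_space.expectation M (\<lambda>\<omega>. (norm (Z k (n k) \<omega> - zs))\<^sup>2)
        + 2 * \<alpha> (Suc k) * \<sigma>\<^sup>2 / \<mu>"
proof -
  interpret prob_space M by fact
  let ?k = "Suc k"
  define a where "a = \<alpha> ?k"
  note a = \<alpha>[folded a_def]
  define e where "e j = expectation (\<lambda>\<omega>. (norm (Z ?k j \<omega> - zs))\<^sup>2)" for j
  have Z0: "Z ?k 0 = Z k (n k)"
    by (simp add: Z_def fun_eq_iff)
  have ZS: "Z ?k (Suc j) = (\<lambda>\<omega>. (fst (Z ?k j \<omega>) - a *\<^sub>R Gx (Z ?k j \<omega>) (\<zeta> ?k j \<omega>),
      snd (Z ?k j \<omega>) + a *\<^sub>R Gy (Z ?k j \<omega>) (\<xi> ?k j \<omega>)))" for j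
    unfolding Z_def a_def by (rule mgda_Suc)
  have meas_Suc: "Z ?k (Suc j) \<in> borel_measurable M"
    if j: "j < n ?k" and [measurable]: "Z ?k j \<in> borel_measurable M" for j
  proof -
    have [measurable]: "\<zeta> ?k j \<in> measurable M S" "\<xi> ?k j \<in> measurable M T"
      using estimates[OF j] by (simp_all add: stochastic_oracle_at_def)
    have "(\<lambda>\<omega>. (\<lambda>(z, s). Gx z s) (Z ?k j \<omega>, \<zeta> ?k j \<omega>)) \<in> borel_measurable M"
      "(\<lambda>\<omega>. (\<lambda>(z, s). Gy z s) (Z ?k j \<omega>, \<xi> ?k j \<omega>)) \<in> borel_measurable M"
      by measurable
    then have [measurable]: "(\<lambda>\<omega>. Gx (Z ?k j \<omega>) (\<zeta> ?k j \<omega>)) \<in> borel_measurable M"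
      "(\<lambda>\<omega>. Gy (Z ?k j \<omega>) (\<xi> ?k j \<omega>)) \<in> borel_measurable M"
      by simp_all
    note [measurable] = borel_measurable_fst[OF that(2)] borel_measurable_snd[OF that(2)]
    show ?thesis
      unfolding ZS by measurable
  qed
  have step: "integrable M (\<lambda>\<omega>. (norm (Z ?k (Suc j) \<omega> - zs))\<^sup>2) \<and>
      e (Suc j) \<le> (1 - a * \<mu>) * e j + 2 * a\<^sup>2 * \<sigma>\<^sup>2"
    if j: "j < n ?k" and "Z ?k j \<in> borel_measurable M"
      "integrable M (\<lambda>\<omega>. (norm (Z ?k j \<omega> - zs))\<^sup>2)" for j
  proof -
    note o = estimates[OF j, unfolded stochastic_oracle_at_def Let_def]
    show ?thesis
      unfolding e_def ZS using o
      by (intro conjI expectation_stochastic_step[OF prob_space_axioms that(2,3) _ _ _ _ less_imp_le[OF a(1)] a(2)])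
        blast+
  qed
  have all: "Z ?k j \<in> borel_measurable M \<and> integrable M (\<lambda>\<omega>. (norm (Z ?k j \<omega> - zs))\<^sup>2)"
    if "j \<le> n ?k" for j
    using that
  proof (induction j)
    case 0
    then show ?case
      using meas int by (simp add: Z0)
  next
    case (Suc j)
    then show ?case
      using meas_Suc[of j] step[of j] by simp
  qed
  from all[of "n ?k"] show "Z ?k (n ?k) \<in> borel_measurable M"
    "integrable M (\<lambda>\<omega>. (norm (Z ?k (n ?k) \<omega> - zs))\<^sup>2)"
    by simp_all
  \<comment> \<open>The contraction factor \<open>1 - a * \<mu>\<close> must be nonnegative for the
    iteration. The stepsize condition gives
    \<open>4 * L\<^sup>2 * (a * \<mu>) \<le> \<mu>\<^sup>2\<close>, and
    \<open>\<mu> \<le> L\<close>.\<close>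
  have "a * \<mu> \<le> 1"
  proof -
    have "4 * L\<^sup>2 * (a * \<mu>) \<le> \<mu> * \<mu>"
      using mult_right_mono[OF a(2), of \<mu>] \<mu>_pos by (simp add: mult.assoc)
    also have "\<dots> \<le> L * L"
      using \<mu>_pos \<mu>_le_L by (intro mult_mono) auto
    also have "\<dots> \<le> 4 * L\<^sup>2 * 1"
      by (simp add: power2_eq_square)
    finally show ?thesis
      using L_pos by simp
  qed
  \<comment> \<open>The noise of one step is written as \<open>q\<close> times the fixed point of
    the recursion, which is the noise level left at the end of the stage.\<close>
  moreover have "e (Suc j) \<le> (1 - a * \<mu>) * e j + a * \<mu> * (2 * a * \<sigma>\<^sup>2 / \<mu>)" if "j < n ?k" for j
  proof -
    have "a * \<mu> * (2 * a * \<sigma>\<^sup>2 / \<mu>) = 2 * a\<^sup>2 * \<sigma>\<^sup>2"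
      using \<mu>_pos by (simp add: power2_eq_square)
    with step[OF that] all[of j] that show ?thesis
      by simp
  qed
  ultimately have "e (n ?k) \<le> exp (- (a * \<mu>) * real (n ?k)) * e 0 + 2 * a * \<sigma>\<^sup>2 / \<mu>"
    using a(1) \<mu>_pos by (intro affine_recursion_bound) (auto simp: e_def)
  then show "expectation (\<lambda>\<omega>. (norm (Z ?k (n ?k) \<omega> - zs))\<^sup>2)
      \<le> exp (- (\<alpha> ?k * \<mu>) * real (n ?k)) * expectation (\<lambda>\<omega>. (norm (Z k (n k) \<omega> - zs))\<^sup>2)
        + 2 * \<alpha> ?k * \<sigma>\<^sup>2 / \<mu>"
    by (simp add: e_def Z0 a_def)
qed

section \<open>Passing to common constants, and the convergence bound\<close>

lemma strongly_convex_mono: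
  fixes \<phi> :: "'a::real_inner \<Rightarrow> real"
  assumes "strongly_convex \<nu> \<phi>" "\<nu>' \<le> \<nu>"
  shows "strongly_convex \<nu>' \<phi>"
  unfolding strongly_convex_def
proof (intro allI)
  fix u v :: 'a
  have "\<nu>' / 2 * (norm (u - v))\<^sup>2 \<le> \<nu> / 2 * (norm (u - v))\<^sup>2"
    using assms(2) by (intro mult_right_mono) auto
  also have "\<dots> \<le> \<phi> u - \<phi> v - grad \<phi> v \<bullet> (u - v)"
    using assms(1) by (simp add: strongly_convex_def)
  finally show "\<nu>' / 2 * (norm (u - v))\<^sup>2 \<le> \<phi> u - \<phi> v - grad \<phi> v \<bullet> (u - v)" .
qed

lemma smooth_mono:
  assumes "smooth l \<phi>" "l \<le> l'"
  shows "smooth l' \<phi>"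
  using assms unfolding smooth_def by (meson mult_right_mono norm_ge_zero order_trans)

text \<open>Square integrability is asserted together with the bound: the expectation of a
  non-integrable function is 0 by convention, so the bound alone would hold trivially in that
  case.\<close>

theorem theorem4p1:
  fixes f :: "(real^'m) \<times> (real ^ 'n) \<Rightarrow> real"
    and \<mu>x \<mu>y Lx Ly Lxy Lyx \<mu> L \<kappa> \<sigma> p :: real
    and zs z0 :: "(real^'m) \<times> (real ^ 'n)"
    and M :: "'w measure" and S :: "'s measure" and T :: "'t measure"
    and Gx :: "(real^'m) \<times> (real ^ 'n) \<Rightarrow> 's \<Rightarrow> real ^ 'm"
    and Gy :: "(real^'m) \<times> (real ^ 'n) \<Rightarrow> 't \<Rightarrow> real ^ 'n"
    and \<zeta> :: "nat \<Rightarrow> nat \<Rightarrow> 'w \<Rightarrow> 's" and \<xi> :: "nat \<Rightarrow> nat \<Rightarrow> 'w \<Rightarrow> 't"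
    and \<alpha> :: "nat \<Rightarrow> real" and n :: "nat \<Rightarrow> nat" and K :: nat
    and Z :: "nat \<Rightarrow> nat \<Rightarrow> 'w \<Rightarrow> (real^'m) \<times> (real ^ 'n)"
  assumes f_C1: "continuously_differentiable f"
    and mu_pos: "\<mu>x > 0" "\<mu>y > 0"
    and f_x: "\<And>y. smooth Lx (\<lambda>x. f (x, y)) \<and> strongly_convex \<mu>x (\<lambda>x. f (x, y))"
    and f_y: "\<And>x. smooth Ly (\<lambda>y. f (x, y)) \<and> strongly_concave \<mu>y (\<lambda>y. f (x, y))"
    and f_xy: "\<And>x y y'. norm (grad_x f (x, y) - grad_x f (x, y')) \<le> Lxy * norm (y - y')"
    and f_yx: "\<And>x x' y. norm (grad_y f (x, y) - grad_y f (x', y)) \<le> Lyx * norm (x - x')"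
    and mu_def: "\<mu> = min \<mu>x \<mu>y"
    and L_def: "L = Max {Lx, Ly, Lxy, Lyx}"
    and kappa_def: "\<kappa> = L / \<mu>"
    and saddle: "saddle_point f zs"
    and prob: "prob_space M"
    and Gx_meas: "(\<lambda>(z, s). Gx z s) \<in> measurable (borel \<Otimes>\<^sub>M S) borel"
    and Gy_meas: "(\<lambda>(z, t). Gy z t) \<in> measurable (borel \<Otimes>\<^sub>M T) borel"
    and Z_def: "Z = mgda Gx Gy \<zeta> \<xi> \<alpha> n z0"
    and estimates: "\<And>k j. 1 \<le> k \<Longrightarrow> k \<le> K \<Longrightarrow> j < n k \<Longrightarrow>
        stochastic_oracle_at M f \<sigma> S T Gx Gy \<zeta> \<xi> n Z k j"
    and p_ge: "p \<ge> 2"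
    and alpha_1: "\<alpha> 1 = \<mu> / (4 * L\<^sup>2)"
    and n_1: "n 1 \<ge> 1"
    and alpha_k: "\<And>k. 2 \<le> k \<Longrightarrow> k \<le> K \<Longrightarrow> \<alpha> k = \<mu> / (L\<^sup>2 * 2 ^ (k + 2))"
    and n_k: "\<And>k. 2 \<le> k \<Longrightarrow> k \<le> K \<Longrightarrow> n k = nat \<lceil>p * 2 ^ (k + 2) * \<kappa>\<^sup>2 * ln 2\<rceil>"
  shows "\<forall>k. 1 \<le> k \<and> k \<le> K \<longrightarrow>
    integrable M (\<lambda>\<omega>. (norm (Z k (n k) \<omega> - zs))\<^sup>2) \<and>
    prob_space.expectation M (\<lambda>\<omega>. (norm (Z k (n k) \<omega> - zs))\<^sup>2)
      \<le> exp (- real (n 1) / (4 * \<kappa>\<^sup>2)) / 2 powr (p * (real k - 1)) * (norm (z0 - zs))\<^sup>2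
         + \<sigma>\<^sup>2 / (2 ^ k * L\<^sup>2)"
proof -
  interpret smooth_saddle f \<mu> L zs
  proof
    have le: "\<mu> \<le> \<mu>x" "\<mu> \<le> \<mu>y" "Lx \<le> L" "Ly \<le> L" "Lxy \<le> L" "Lyx \<le> L"
      by (simp_all add: mu_def L_def)
    show "f differentiable (at z)" for z
      using f_C1 unfolding continuously_differentiable_def by blast
    show "\<mu> > 0"
      using mu_pos by (simp add: mu_def)
    show "strongly_convex \<mu> (\<lambda>x. f (x, y))" "smooth L (\<lambda>x. f (x, y))" for y
      using f_x le by (blast intro: strongly_convex_mono smooth_mono)+
    show "strongly_concave \<mu> (\<lambda>y. f (x, y))" "smooth L (\<lambda>y. f (x, y))" for x
      using f_y le unfolding strongly_concave_def by (blast intro: strongly_convex_mono smooth_mono)+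
    show "norm (grad_x f (x, y) - grad_x f (x, y')) \<le> L * norm (y - y')" for x y y'
      using f_xy le by (meson mult_right_mono norm_ge_zero order_trans)
    show "norm (grad_y f (x, y) - grad_y f (x', y)) \<le> L * norm (x - x')" for x x' y
      using f_yx le by (meson mult_right_mono norm_ge_zero order_trans)
    show "saddle_point f zs"
      by fact
  qed
  interpret prob_space M by fact
  define E where "E k = expectation (\<lambda>\<omega>. (norm (Z k (n k) \<omega> - zs))\<^sup>2)" for k
  define c where "c = exp (- real (n 1) / (4 * \<kappa>\<^sup>2)) * (norm (z0 - zs))\<^sup>2"
  \<comment> \<open>Stage 0 is constantly \<open>z0\<close> at every index, so
    \<open>Z 0 (n 0)\<close> is the initial point whatever \<open>n 0\<close> is, and stage 1 needs
    no separate treatment as a stage.\<close>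
  have Z0: "Z 0 j = (\<lambda>_. z0)" for j
    by (simp add: Z_def fun_eq_iff)
  have \<alpha>: "0 < \<alpha> (Suc k)" "4 * L\<^sup>2 * \<alpha> (Suc k) \<le> \<mu>" if "Suc k \<le> K" for k
  proof -
    have "0 < \<alpha> (Suc k) \<and> 4 * L\<^sup>2 * \<alpha> (Suc k) \<le> \<mu>"
    proof (cases "k = 0")
      \<comment> \<open>For stage 1 the stepsize condition holds with equality; later stepsizes are
        smaller, since \<open>2 ^ (Suc k + 2) \<ge> 4\<close>.\<close>
      case True
      then show ?thesis
        using alpha_1 \<mu>_pos L_pos by simp
    next
      case False
      have a: "\<alpha> (Suc k) = \<mu> / (L\<^sup>2 * 2 ^ (Suc k + 2))"
        using False that by (intro alpha_k) auto
      have "4 / 2 ^ (Suc k + 2) \<le> (1::real)"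
        using power_increasing[of 2 "Suc k + 2" "2::real"] by simp
      then have "\<mu> * (4 / 2 ^ (Suc k + 2)) \<le> \<mu> * 1"
        using \<mu>_pos by (intro mult_left_mono) auto
      then show ?thesis
        using \<mu>_pos L_pos by (simp add: a)
    qed
    then show "0 < \<alpha> (Suc k)" "4 * L\<^sup>2 * \<alpha> (Suc k) \<le> \<mu>"
      by simp_all
  qed
  note stage = expectation_mgda_stage[OF prob Gx_meas Gy_meas Z_def]
  have reg: "Z k (n k) \<in> borel_measurable M \<and> integrable M (\<lambda>\<omega>. (norm (Z k (n k) \<omega> - zs))\<^sup>2)"
    if "k \<le> K" for k
    using that
  proof (induction k)
    case 0
    then show ?case by (simp add: Z0)
  next
    case (Suc k)
    then show ?case
      using stage[of k \<sigma>] estimates[of "Suc k"] \<alpha>[of k] by simp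
  qed
  have E_Suc: "E (Suc k) \<le> exp (- (\<alpha> (Suc k) * \<mu>) * real (n (Suc k))) * E k + 2 * \<alpha> (Suc k) * \<sigma>\<^sup>2 / \<mu>"
    if "Suc k \<le> K" for k
    unfolding E_def using reg[of k] that
    by (intro stage estimates \<alpha>) auto
  have bound: "E (Suc k) \<le> c / 2 powr (p * real k) + \<sigma>\<^sup>2 / (2 ^ Suc k * L\<^sup>2)" if "Suc k \<le> K" for k
    using that
  proof (induction k)
    case 0
    \<comment> \<open>The first stage produces the exponential inside \<open>c\<close> and exactly
      the claimed noise level; the powers of \<open>2 powr (- p)\<close> start with the second
      stage.\<close>
    have "\<alpha> (Suc 0) * \<mu> = 1 / (4 * \<kappa>\<^sup>2)" "2 * \<alpha> (Suc 0) * \<sigma>\<^sup>2 / \<mu> = \<sigma>\<^sup>2 / (2 * L\<^sup>2)"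
      using alpha_1 \<mu>_pos L_pos by (simp_all add: kappa_def field_simps power2_eq_square)
    moreover have "E 0 = (norm (z0 - zs))\<^sup>2"
      by (simp add: E_def Z0 prob_space)
    ultimately show ?case
      using E_Suc[OF 0] by (simp add: c_def)
  next
    case (Suc k)
    let ?k = "Suc (Suc k)"
    have n: "n ?k = nat \<lceil>p * 2 ^ (?k + 2) * \<kappa>\<^sup>2 * ln 2\<rceil>" and a: "\<alpha> ?k = \<mu> / (L\<^sup>2 * 2 ^ (?k + 2))"
      using Suc.prems by (intro n_k alpha_k; simp)+
    have \<kappa>: "\<kappa> > 0"
      using \<mu>_pos L_pos by (simp add: kappa_def)
    \<comment> \<open>The stage length is \<open>p * ln 2\<close> divided by this rate, rounded up,
      so the stage contracts at least by the factor
      \<open>exp (- p * ln 2) = 2 powr (- p)\<close>.\<close>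
    have aq: "\<alpha> ?k * \<mu> = 1 / (2 ^ (?k + 2) * \<kappa>\<^sup>2)"
      using \<mu>_pos L_pos by (simp add: a kappa_def field_simps power2_eq_square)
    have "p * 2 ^ (?k + 2) * \<kappa>\<^sup>2 * ln 2 \<le> real (n ?k)"
      unfolding n by (rule real_nat_ceiling_ge)
    then have "p * ln 2 \<le> \<alpha> ?k * \<mu> * real (n ?k)"
      unfolding aq using \<kappa> by (simp add: field_simps del: power_Suc)
    then have "exp (- (\<alpha> ?k * \<mu>) * real (n ?k)) \<le> 2 powr (- p)"
      by (simp add: powr_def)
    moreover have "E (Suc k) \<ge> 0"
      by (simp add: E_def)
    ultimately have "E ?k \<le> 2 powr (- p) * E (Suc k) + 2 * \<alpha> ?k * \<sigma>\<^sup>2 / \<mu>"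
      using E_Suc[OF Suc.prems] by (smt (verit) mult_right_mono)
    also have "\<dots> \<le> 2 powr (- p) * (c / 2 powr (p * real k) + \<sigma>\<^sup>2 / (2 ^ Suc k * L\<^sup>2)) + 2 * \<alpha> ?k * \<sigma>\<^sup>2 / \<mu>"
      using Suc by (intro add_right_mono mult_left_mono) auto
    also have "\<dots> = c / 2 powr (p * real (Suc k))
        + 2 powr (- p) * (\<sigma>\<^sup>2 / (2 ^ Suc k * L\<^sup>2)) + 2 * \<alpha> ?k * \<sigma>\<^sup>2 / \<mu>"
      by (simp add: distrib_left powr_minus powr_add field_simps)
    \<comment> \<open>Here \<open>p \<ge> 2\<close> enters. The inherited noise shrinks to at most a
      quarter of the previous level, and the fresh noise of the stage is exactly another quarter;
      together they make the half that the next level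
      \<open>\<sigma>\<^sup>2 / (2 ^ ?k * L\<^sup>2)\<close> allows.\<close>
    also have "2 powr (- p) * (\<sigma>\<^sup>2 / (2 ^ Suc k * L\<^sup>2)) \<le> 1 / 4 * (\<sigma>\<^sup>2 / (2 ^ Suc k * L\<^sup>2))"
    proof (rule mult_right_mono)
      have "2 powr (- p) \<le> 2 powr (- 2 :: real)"
        using p_ge by (intro powr_mono) auto
      then show "2 powr (- p) \<le> 1 / 4"
        by (simp add: powr_minus powr_numeral)
    qed simp
    also have "2 * \<alpha> ?k * \<sigma>\<^sup>2 / \<mu> = 1 / 4 * (\<sigma>\<^sup>2 / (2 ^ Suc k * L\<^sup>2))"
      using \<mu>_pos L_pos by (simp add: a field_simps)
    also have "c / 2 powr (p * real (Suc k)) + 1 / 4 * (\<sigma>\<^sup>2 / (2 ^ Suc k * L\<^sup>2))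
        + 1 / 4 * (\<sigma>\<^sup>2 / (2 ^ Suc k * L\<^sup>2)) = c / 2 powr (p * real (Suc k)) + \<sigma>\<^sup>2 / (2 ^ ?k * L\<^sup>2)"
      by simp
    finally show ?case
      by simp
  qed
  show ?thesis
  proof (intro allI impI conjI)
    fix k assume k: "1 \<le> k \<and> k \<le> K"
    then show "integrable M (\<lambda>\<omega>. (norm (Z k (n k) \<omega> - zs))\<^sup>2)"
      using reg by simp
    from k obtain l where "k = Suc l"
      by (metis Suc_le_D One_nat_def)
    with k bound[of l] show "expectation (\<lambda>\<omega>. (norm (Z k (n k) \<omega> - zs))\<^sup>2)
      \<le> exp (- real (n 1) / (4 * \<kappa>\<^sup>2)) / 2 powr (p * (real k - 1)) * (norm (z0 - zs))\<^sup>2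
         + \<sigma>\<^sup>2 / (2 ^ k * L\<^sup>2)"
      by (simp add: E_def c_def)
  qed
qed

end
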